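(* Consider a two-user distributed multiple access channel with independent bursty arrivals and fixed fading coefficients $\sqrt{\alpha_1},\sqrt{\alpha_2}$, where $\alpha_1\ge\alpha_2>0$. Let $B_1,B_2$ be the independent per-slot rate requirements of the two users, each taking finitely many nonnegative values, and let $b_i(\cdot)$ be the inverse CDF of $B_i$. Then the minimum average sum-power required under a unit slot delay constraint $D_{max}=1$ is $$P_{avg}^{min}(1)=\int_0^{1-\frac{\alpha_2}{\alpha_1}}\frac{2^{2b_2(x)}-1}{\alpha_2}\,dx+\int_0^{\frac{\alpha_2}{\alpha_1}}\frac{2^{2\left(b_2\left(v+1-\frac{\alpha_2}{\alpha_1}\right)+b_1\left(\frac{\alpha_1 v}{\alpha_2}\right)\right)}-1}{\alpha_2}\,dv .$$
   Context: Model: time is slotted. At the start of each slot, user $i\in\{1,2\}$ observes only its own required rate, which is i.i.d. across slots with the law of $B_i$; $B_1$ and $B_2$ are independent. Under the unit slot delay constraint $D_{max}=1$ the entire arriving rate must be transmitted in the slot of arrival, and user $i$ chooses its transmit power as a function $P_i(B_i)\ge 0$ of its own rate only. Rate law: $\Pr(B_i=b_{ik})=\lambda_{ik}>0$, $1\le k\le K_i$, with $0\le b_{i1}<b_{i2}<\dots<b_{iK_i}$. Outage free: a pair of power allocation functions $(P_1,P_2)$, with $P_i:\{b_{i1},\dots,b_{iK_i}\}\to[0,\infty)$, is outage free if for every $b_1$ in the support of $B_1$ and every $b_2$ in the support of $B_2$, $$\alpha_1P_1(b_1)\ge 2^{2b_1}-1,\quad \alpha_2P_2(b_2)\ge 2^{2b_2}-1,\quad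 \alpha_1P_1(b_1)+\alpha_2P_2(b_2)\ge 2^{2(b_1+b_2)}-1 .$$ Minimum average sum-power: $P_{avg}^{min}(1)=\inf\,\bigl(\mathbb E[P_1(B_1)]+\mathbb E[P_2(B_2)]\bigr)$, the infimum being over all outage free pairs $(P_1,P_2)$. Inverse CDF: with $\phi_i$ the CDF of $B_i$, $b_i(x)=\sup\{b\in\mathbb R:\phi_i(b)<x\}$ for $0<x\le 1$ and $b_i(0)=\sup\{b\in\mathbb R:\phi_i(b)\le 0\}$. *)

theory Defs
  imports "HOL-Probability.Probability"
begin

definition rate_law ::
  "'a measure \<Rightarrow> ('a \<Rightarrow> real) \<Rightarrow> nat \<Rightarrow> (nat \<Rightarrow> real) \<Rightarrow> (nat \<Rightarrow> real) \<Rightarrow> bool" where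
  "rate_law M B K r l \<longleftrightarrow>
     B \<in> borel_measurable M \<and> 1 \<le> K \<and> 0 \<le> r 1 \<and> strict_mono_on {1..K} r \<and>
     (\<forall>k\<in>{1..K}. 0 < l k \<and> measure M {\<omega> \<in> space M. B \<omega> = r k} = l k) \<and>
     (\<Sum>k=1..K. l k) = 1"

definition rate_support :: "'a measure \<Rightarrow> ('a \<Rightarrow> real) \<Rightarrow> real set" where
  "rate_support M B = {b. 0 < measure M {\<omega> \<in> space M. B \<omega> = b}}"

text \<open>Power allocations are functions on the support only, hence the extensional function space.
  Since they are constant off a finite set, they are Borel measurable, so that the
  expectations below are never the default value of a non-integrable function.\<close>

definition outage_free ::
  "real \<Rightarrow> real \<Rightarrow> 'a measure \<Rightarrow> ('a \<Rightarrow> real) \<Rightarrow> ('a \<Rightarrow> real) \<Rightarrow>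
   (real \<Rightarrow> real) \<Rightarrow> (real \<Rightarrow> real) \<Rightarrow> bool" where
  "outage_free \<alpha>1 \<alpha>2 M B1 B2 P1 P2 \<longleftrightarrow>
     P1 \<in> rate_support M B1 \<rightarrow>\<^sub>E {0..} \<and> P2 \<in> rate_support M B2 \<rightarrow>\<^sub>E {0..} \<and>
     (\<forall>b1\<in>rate_support M B1. \<forall>b2\<in>rate_support M B2.
        \<alpha>1 * P1 b1 \<ge> 2 powr (2 * b1) - 1 \<and>
        \<alpha>2 * P2 b2 \<ge> 2 powr (2 * b2) - 1 \<and>
        \<alpha>1 * P1 b1 + \<alpha>2 * P2 b2 \<ge> 2 powr (2 * (b1 + b2)) - 1)"

text \<open>Minimum average sum-power under the unit slot delay constraint.\<close>

definition min_avg_sum_power ::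
  "real \<Rightarrow> real \<Rightarrow> 'a measure \<Rightarrow> ('a \<Rightarrow> real) \<Rightarrow> ('a \<Rightarrow> real) \<Rightarrow> real" where
  "min_avg_sum_power \<alpha>1 \<alpha>2 M B1 B2 =
     Inf {(\<integral>\<omega>. P1 (B1 \<omega>) \<partial>M) + (\<integral>\<omega>. P2 (B2 \<omega>) \<partial>M) | P1 P2.
            outage_free \<alpha>1 \<alpha>2 M B1 B2 P1 P2}"

text \<open>Only the arguments \<open>0 \<le> x \<le> 1\<close> are meaningful.\<close>

definition inverse_cdf :: "'a measure \<Rightarrow> ('a \<Rightarrow> real) \<Rightarrow> real \<Rightarrow> real" where
  "inverse_cdf M B x =
     (if x = 0 then Sup {b. cdf (distr M borel B) b \<le> 0}
      else Sup {b. cdf (distr M borel B) b < x})"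

end

theory Submission
  imports Defs
begin

text \<open>
  With \<open>\<rho> = \<alpha>2 / \<alpha>1\<close> and \<open>s = 2 powr (2 * b)\<close>, the scaled powers \<open>x = \<alpha>1 * P1\<close> and
  \<open>y = \<alpha>2 * P2\<close> satisfy \<open>x + y \<ge> s1 * s2 - 1\<close>, and the objective is \<open>\<rho> * E x + E y\<close> up to the
  factor \<open>1 / \<alpha>2\<close>. Pairing the upper mass \<open>\<rho>\<close> of user 2 comonotonically with all of user 1 and using
  the individual constraint on the remaining mass of user 2 gives the lower bound. The paired
  values lie on a finite chain in the plane, and a finite chain has Kantorovich potentials for the
  supermodular cost \<open>a * b\<close>: functions with \<open>f a + g b \<ge> a * b\<close> and equality on the chain.
  These potentials, shifted so that the rate \<open>0\<close> of user 1 costs nothing, are outage free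
  powers that attain the bound.
\<close>

section \<open>Potentials on a finite chain in the plane\<close>

lemma finite_chain_potentials:
  fixes S :: "(real \<times> real) set"
  assumes "finite S"
    and "\<And>s t. s \<in> S \<Longrightarrow> t \<in> S \<Longrightarrow> s \<le> t \<or> t \<le> s"
  obtains f g :: "real \<Rightarrow> real"
  where "\<And>a b. (a, b) \<in> S \<Longrightarrow> f a + g b = a * b"
    and "\<And>a b. a \<in> fst ` S \<Longrightarrow> b \<in> snd ` S \<Longrightarrow> a * b \<le> f a + g b"
proof -
  \<comment> \<open>\<open>X\<close> and \<open>Y\<close> are indexed by points of the chain, not by
    coordinates, so a new point gets fresh values even if it shares a coordinate with an old one.
    Dependence on the coordinate alone is recovered after the induction.\<close>
  let ?Pot = "\<lambda>S X Y. \<forall>s\<in>S. X s + Y s = fst s * snd s \<and>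
      (\<forall>t\<in>S. fst s * snd t \<le> X s + Y t)"
  have "\<exists>X Y :: real \<times> real \<Rightarrow> real. ?Pot S X Y"
    using assms
  \<comment> \<open>Among comparable points the coordinate sum ranks like the order itself, so each
    new point lies above all earlier ones.\<close>
  proof (induction S rule: finite_ranking_induct[where f = "\<lambda>s. fst s + snd s"])
    case empty
    then show ?case by simp
  next
    case (insert z S)
    then obtain X Y where XY: "?Pot S X Y"
      by (metis insertCI)
    have le_z: "t \<le> z" if "t \<in> S" for t
      using insert.hyps(2)[OF that] insert.prems[of t z] that
      by (auto simp: less_eq_prod_def)
    show ?case
    proof (cases "S = {}")
      case True
      show ?thesis
        by (rule exI[of _ "\<lambda>_. fst z * snd z"], rule exI[of _ "\<lambda>_. 0"]) (simp add: True)
    next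
      case False
      obtain m where m: "m \<in> S" "fst m + snd m = Max ((\<lambda>s. fst s + snd s) ` S)"
        by (rule obtains_MAX[OF insert.hyps(1) False, of "\<lambda>s. fst s + snd s"]) simp
      have max_m: "fst t + snd t \<le> fst m + snd m" if "t \<in> S" for t
        unfolding m(2) using insert.hyps(1) that by (intro Max_ge) auto
      have le_m: "t \<le> m" if "t \<in> S" for t
        using max_m[OF that] insert.prems[of t m] that m(1) by (auto simp: less_eq_prod_def)
      \<comment> \<open>The step from \<open>m\<close> to \<open>z\<close> is a staircase:
        \<open>X\<close> collects the area of the horizontal move at height \<open>snd m\<close>,
        \<open>Y\<close> that of the vertical move at abscissa \<open>fst z\<close>. The two
        increments add up to \<open>fst z * snd z - fst m * snd m\<close>.\<close>
      define X' where "X' = X(z := X m + snd m * (fst z - fst m))"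
      define Y' where "Y' = Y(z := Y m + fst z * (snd z - snd m))"
      show ?thesis
      proof (cases "z \<in> S")
        case True
        then show ?thesis using XY by (auto simp: insert_absorb)
      next
        case zS: False
        have "X m + Y m = fst m * snd m" using XY m(1) by blast
        then have zz: "X' z + Y' z = fst z * snd z"
          by (simp add: X'_def Y'_def algebra_simps)
        have old: "X' t = X t" "Y' t = Y t" if "t \<in> S" for t
          using that zS by (auto simp: X'_def Y'_def)
        \<comment> \<open>Replacing \<open>m\<close> by \<open>z\<close> in the inequality for
          \<open>t\<close> and \<open>m\<close> adds the slack
          \<open>(fst z - fst t) * (snd z - snd m)\<close> here and
          \<open>(snd m - snd t) * (fst z - fst m)\<close> in \<open>zt\<close>. Both are
          nonnegative because \<open>t \<le> m \<le> z\<close>.\<close>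
        have tz: "fst t * snd z \<le> X' t + Y' z" if "t \<in> S" for t
        proof -
          have "fst t * snd m \<le> X t + Y m" using XY that m(1) by blast
          moreover have "fst t * (snd z - snd m) \<le> fst z * (snd z - snd m)"
            using le_z[OF that] le_z[OF m(1)] by (intro mult_right_mono) (auto simp: less_eq_prod_def)
          ultimately show ?thesis
            using that zS by (auto simp: X'_def Y'_def algebra_simps)
        qed
        have zt: "fst z * snd t \<le> X' z + Y' t" if "t \<in> S" for t
        proof -
          have "fst m * snd t \<le> X m + Y t" using XY that m(1) by blast
          moreover have "snd t * (fst z - fst m) \<le> snd m * (fst z - fst m)"
            using le_m[OF that] le_z[OF m(1)] by (intro mult_right_mono) (auto simp: less_eq_prod_def)
          ultimately show ?thesis
            using that zS by (auto simp: X'_def Y'_def algebra_simps)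
        qed
        have "?Pot (insert z S) X' Y'"
          using XY zz tz zt old by simp
        then show ?thesis by blast
      qed
    qed
  qed
  then obtain X Y where XY: "?Pot S X Y" by blast
  \<comment> \<open>The equality at two pairs with the same first (second) component and the inequalities
    between them force \<open>X\<close> (\<open>Y\<close>) to agree there.\<close>
  have X_fst: "X s = X t" if "s \<in> S" "t \<in> S" "fst s = fst t" for s t
    using XY that by (smt (verit))
  have Y_snd: "Y s = Y t" if "s \<in> S" "t \<in> S" "snd s = snd t" for s t
    using XY that by (smt (verit))
  define f where "f a = X (SOME s. s \<in> S \<and> fst s = a)" for a
  define g where "g b = Y (SOME s. s \<in> S \<and> snd s = b)" for b
  have f: "f (fst s) = X s" if "s \<in> S" for s
    unfolding f_def using someI[of "\<lambda>t. t \<in> S \<and> fst t = fst s" s] that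
    by (intro X_fst) auto
  have g: "g (snd s) = Y s" if "s \<in> S" for s
    unfolding g_def using someI[of "\<lambda>t. t \<in> S \<and> snd t = snd s" s] that
    by (intro Y_snd) auto
  show ?thesis
  proof
    show "f a + g b = a * b" if "(a, b) \<in> S" for a b
      using XY f[OF that] g[OF that] that by force
    show "a * b \<le> f a + g b" if ab: "a \<in> fst ` S" "b \<in> snd ` S" for a b
    proof -
      obtain s t where "s \<in> S" "t \<in> S" "a = fst s" "b = snd t"
        using ab by (elim imageE)
      then show ?thesis using XY f g by simp
    qed
  qed
qed

section \<open>The law of one user's rate\<close>

locale finite_rate = prob_space M for M :: "'a measure" +
  fixes B :: "'a \<Rightarrow> real" and K :: nat and r l :: "nat \<Rightarrow> real"
  assumes rate_law: "rate_law M B K r l"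
begin

definition cum :: "nat \<Rightarrow> real" where "cum k = (\<Sum>i=1..k. l i)"

abbreviation Q :: "real \<Rightarrow> real" where "Q \<equiv> inverse_cdf M B"

lemma B_measurable [measurable]: "B \<in> borel_measurable M"
  and K_pos: "1 \<le> K"
  and r1_nonneg: "0 \<le> r 1"
  and r_strict_mono: "strict_mono_on {1..K} r"
  and l_pos: "k \<in> {1..K} \<Longrightarrow> 0 < l k"
  and prob_B_eq: "k \<in> {1..K} \<Longrightarrow> prob {\<omega> \<in> space M. B \<omega> = r k} = l k"
  and cum_K: "cum K = 1"
  using rate_law by (auto simp: rate_law_def cum_def)

lemma cum_0 [simp]: "cum 0 = 0"
  by (simp add: cum_def)

lemma cum_Suc: "cum (Suc k) = cum k + l (Suc k)"
  by (simp add: cum_def)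

lemma r_eq_iff: "i \<in> {1..K} \<Longrightarrow> j \<in> {1..K} \<Longrightarrow> r i = r j \<longleftrightarrow> i = j"
  using strict_mono_on_imp_inj_on[OF r_strict_mono] by (rule inj_on_eq_iff)

lemma r_less_iff: "i \<in> {1..K} \<Longrightarrow> j \<in> {1..K} \<Longrightarrow> r i < r j \<longleftrightarrow> i < j"
  using strict_mono_on_less[OF r_strict_mono] by blast

lemma r_le_iff: "i \<in> {1..K} \<Longrightarrow> j \<in> {1..K} \<Longrightarrow> r i \<le> r j \<longleftrightarrow> i \<le> j"
  using strict_mono_on_less_eq[OF r_strict_mono] by blast

lemma cum_mono: "i \<le> j \<Longrightarrow> j \<le> K \<Longrightarrow> cum i \<le> cum j"
  unfolding cum_def by (rule sum_mono2) (use l_pos in \<open>auto intro: less_imp_le\<close>)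

text \<open>The events \<open>B = r k\<close> are disjoint and their probabilities sum to 1, so they
  exhaust the space up to a null set.\<close>

lemma AE_B: "AE \<omega> in M. B \<omega> \<in> r ` {1..K}"
proof -
  have "prob (\<Union>k\<in>{1..K}. {\<omega> \<in> space M. B \<omega> = r k})
      = (\<Sum>k=1..K. prob {\<omega> \<in> space M. B \<omega> = r k})"
  proof (rule finite_measure_finite_Union)
    show "disjoint_family_on (\<lambda>k. {\<omega> \<in> space M. B \<omega> = r k}) {1..K}"
      unfolding disjoint_family_on_def using r_eq_iff by fastforce
  qed auto
  also have "\<dots> = 1" using prob_B_eq cum_K by (simp add: cum_def)
  finally have "AE \<omega> in M. \<omega> \<in> (\<Union>k\<in>{1..K}. {\<omega> \<in> space M. B \<omega> = r k})"
    by (rule AE_prob_1)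
  then show ?thesis by eventually_elim auto
qed

lemma expectation_B:
  fixes h :: "real \<Rightarrow> real"
  assumes [measurable]: "h \<in> borel_measurable borel"
  shows "expectation (\<lambda>\<omega>. h (B \<omega>)) = (\<Sum>k=1..K. l k * h (r k))"
proof -
  have "expectation (\<lambda>\<omega>. h (B \<omega>))
      = expectation (\<lambda>\<omega>. \<Sum>k=1..K. h (r k) * indicator {\<omega> \<in> space M. B \<omega> = r k} \<omega>)"
  proof (rule integral_cong_AE)
    show "AE \<omega> in M. h (B \<omega>)
        = (\<Sum>k=1..K. h (r k) * indicator {\<omega> \<in> space M. B \<omega> = r k} \<omega>)"
      using AE_B AE_space
    proof eventually_elim
      case (elim \<omega>)
      then obtain j where j: "j \<in> {1..K}" "B \<omega> = r j" by blast
      have "(\<Sum>k=1..K. h (r k) * indicator {\<omega> \<in> space M. B \<omega> = r k} \<omega>)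
          = (\<Sum>k=1..K. if k = j then h (r k) else 0)"
        using elim(2) j(1) by (intro sum.cong) (simp_all add: indicator_def j(2) r_eq_iff)
      also have "\<dots> = h (B \<omega>)" using j by simp
      finally show ?case ..
    qed
  qed measurable
  also have "\<dots> = (\<Sum>k=1..K. h (r k) * prob {\<omega> \<in> space M. B \<omega> = r k})"
    by (subst Bochner_Integration.integral_sum)
      (auto intro!: integrable_mult_right integrable_real_indicator simp: emeasure_eq_measure)
  also have "\<dots> = (\<Sum>k=1..K. l k * h (r k))"
    by (intro sum.cong) (auto simp: prob_B_eq)
  finally show ?thesis .
qed

lemma cdf_B: "cdf (distr M borel B) b = (\<Sum>k\<in>{k\<in>{1..K}. r k \<le> b}. l k)"
proof -
  have "cdf (distr M borel B) b = prob {\<omega> \<in> space M. B \<omega> \<le> b}"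
    by (simp add: cdf_def measure_distr vimage_def Int_def conj_commute)
  also have "\<dots> = expectation (indicator {\<omega> \<in> space M. B \<omega> \<le> b})"
    by simp
  also have "\<dots> = expectation (\<lambda>\<omega>. indicator {..b} (B \<omega>))"
    by (intro Bochner_Integration.integral_cong) (auto simp: indicator_def)
  also have "\<dots> = (\<Sum>k=1..K. l k * indicator {..b} (r k))"
    by (rule expectation_B) simp
  also have "\<dots> = (\<Sum>k\<in>{k\<in>{1..K}. r k \<le> b}. l k)"
    by (rule sum.mono_neutral_cong_right) (auto simp: indicator_def)
  finally show ?thesis .
qed

lemma rate_support_eq: "rate_support M B = r ` {1..K}"
proof
  show "r ` {1..K} \<subseteq> rate_support M B"
    using prob_B_eq l_pos by (auto simp: rate_support_def)
  show "rate_support M B \<subseteq> r ` {1..K}"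
  proof (rule ccontr)
    assume "\<not> ?thesis"
    then obtain b where b: "0 < prob {\<omega> \<in> space M. B \<omega> = b}" "b \<notin> r ` {1..K}"
      by (auto simp: rate_support_def)
    have "AE \<omega> in M. \<omega> \<notin> {\<omega> \<in> space M. B \<omega> = b}"
      using AE_B by eventually_elim (use b(2) in auto)
    then have "prob {\<omega> \<in> space M. B \<omega> = b} = 0"
      by (subst prob_eq_0) auto
    with b(1) show False by simp
  qed
qed

lemma rate_support_nonneg: "b \<in> rate_support M B \<Longrightarrow> 0 \<le> b"
  using r_le_iff[of 1] K_pos r1_nonneg by (force simp: rate_support_eq)

section \<open>The quantile function as a step function on the unit interval\<close>

lemma cdf_less_r: "k \<in> {1..K} \<Longrightarrow> b < r k \<Longrightarrow> cdf (distr M borel B) b \<le> cum (k - 1)"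
  unfolding cdf_B cum_def
proof (rule sum_mono2)
  assume k: "k \<in> {1..K}" "b < r k"
  then show "{i \<in> {1..K}. r i \<le> b} \<subseteq> {1..k - 1}"
  proof safe
    fix i assume "i \<in> {1..K}" "r i \<le> b"
    with k have "r i < r k" by simp
    with k \<open>i \<in> {1..K}\<close> show "i \<in> {1..k - 1}" by (auto simp: r_less_iff)
  qed
qed (use l_pos in \<open>auto intro: less_imp_le\<close>)

lemma cdf_ge_r: "k \<in> {1..K} \<Longrightarrow> r k \<le> b \<Longrightarrow> cum k \<le> cdf (distr M borel B) b"
  unfolding cdf_B cum_def
proof (rule sum_mono2)
  assume k: "k \<in> {1..K}" "r k \<le> b"
  then show "{1..k} \<subseteq> {i \<in> {1..K}. r i \<le> b}"
    using r_le_iff[of _ k] by force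
qed (use l_pos in \<open>auto intro: less_imp_le\<close>)

text \<open>The CDF is at most \<open>cum (k - 1)\<close> below \<open>r k\<close> and at least
  \<open>cum k\<close> from there on, so a level in between cuts out exactly
  \<open>{..<r k}\<close>.\<close>

lemma Q_step:
  assumes "k \<in> {1..K}" "cum (k - 1) < x" "x \<le> cum k"
  shows "Q x = r k"
proof -
  have "cdf (distr M borel B) b < x \<longleftrightarrow> b < r k" for b
    using cdf_less_r[of k b] cdf_ge_r[of k b] assms by (cases "b < r k") auto
  then have "{b. cdf (distr M borel B) b < x} = {..<r k}" by auto
  moreover have "x \<noteq> 0" using assms cum_mono[of 0 "k - 1"] by force
  ultimately show ?thesis by (simp add: inverse_cdf_def)
qed

text \<open>The level 0 lies in none of the half-open steps; the weak inequality in its own clause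
  makes \<open>Q\<close> continue the first step down to 0.\<close>

lemma Q_0: "Q 0 = r 1"
proof -
  have one: "1 \<in> {1..K}" using K_pos by simp
  have "0 < cum 1" using l_pos[OF one] by (simp add: cum_def)
  then have "cdf (distr M borel B) b \<le> 0 \<longleftrightarrow> b < r 1" for b
    using cdf_less_r[OF one, of b] cdf_ge_r[OF one, of b] by (cases "b < r 1") auto
  then have "{b. cdf (distr M borel B) b \<le> 0} = {..<r 1}" by auto
  then show ?thesis by (simp add: inverse_cdf_def)
qed

lemma Q_cases:
  assumes "0 \<le> x" "x \<le> 1"
  obtains k where "k \<in> {1..K}" "Q x = r k" "x \<le> cum k" "x = 0 \<and> k = 1 \<or> cum (k - 1) < x"
proof (cases "x = 0")
  case True
  show ?thesis
    by (rule that[of 1]) (use True Q_0 K_pos cum_mono[of 0 1] in auto)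
next
  case False
  define k where "k = (LEAST k. x \<le> cum k)"
  have "x \<le> cum K" using assms(2) cum_K by simp
  then have k: "x \<le> cum k" and "k \<le> K"
    unfolding k_def by (rule LeastI, rule Least_le)
  then have "k \<noteq> 0" using False assms(1) by (cases k) auto
  then have "\<not> x \<le> cum (k - 1)"
    unfolding k_def by (intro not_less_Least) simp
  then show ?thesis
    using that[of k] Q_step[of k x] k \<open>k \<le> K\<close> \<open>k \<noteq> 0\<close> by auto
qed

lemma Q_in_support: "0 \<le> x \<Longrightarrow> x \<le> 1 \<Longrightarrow> Q x \<in> rate_support M B"
  unfolding rate_support_eq by (metis Q_cases imageI)

text \<open>Every step has positive length, so its right end \<open>cum k\<close> is a level that
  attains \<open>r k\<close>. This will place every rate of the support on the chain.\<close>

lemma Q_surj: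
  assumes "b \<in> rate_support M B"
  obtains x where "0 \<le> x" "x \<le> 1" "Q x = b"
proof -
  obtain k where k: "k \<in> {1..K}" "b = r k" using assms by (auto simp: rate_support_eq)
  then have "cum (k - 1) < cum k" using l_pos[of k] cum_Suc[of "k - 1"] by auto
  with k show ?thesis
    using that[of "cum k"] Q_step[of k "cum k"] cum_mono[of 0 k] cum_mono[of k K] cum_K by auto
qed

lemma Q_mono:
  assumes "0 \<le> x" "x \<le> y" "y \<le> 1"
  shows "Q x \<le> Q y"
proof -
  obtain i where i: "i \<in> {1..K}" "Q x = r i" "x = 0 \<and> i = 1 \<or> cum (i - 1) < x"
    using Q_cases[of x] assms by (metis order_trans)
  obtain j where j: "j \<in> {1..K}" "Q y = r j" "y \<le> cum j"
    using Q_cases[of y] assms by (metis order_trans)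
  have "i \<le> j"
  proof (rule ccontr)
    assume "\<not> i \<le> j"
    with i j have "cum j \<le> cum (i - 1)" by (intro cum_mono) auto
    with i j \<open>\<not> i \<le> j\<close> assms show False by auto
  qed
  then show ?thesis using i j r_le_iff by simp
qed

text \<open>Inverse transform sampling: a uniform level pushed through \<open>Q\<close> has the law
  of \<open>B\<close>. The integral is built up step by step.\<close>

lemma has_integral_Q:
  fixes h :: "real \<Rightarrow> real"
  shows "((\<lambda>x. h (Q x)) has_integral (\<Sum>k=1..K. l k * h (r k))) {0..1}"
proof -
  have "((\<lambda>x. h (Q x)) has_integral (\<Sum>i=1..k. l i * h (r i))) {0..cum k}" if "k \<le> K" for k
    using that
  proof (induction k)
    case 0
    then show ?case by (simp add: has_integral_refl)
  next
    case (Suc k)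
    have "((\<lambda>x. h (r (Suc k))) has_integral l (Suc k) * h (r (Suc k))) {cum k..cum (Suc k)}"
      using has_integral_const_real[of "h (r (Suc k))" "cum k" "cum (Suc k)"]
        l_pos[of "Suc k"] Suc.prems by (simp add: cum_Suc)
    then have "((\<lambda>x. h (Q x)) has_integral l (Suc k) * h (r (Suc k))) {cum k..cum (Suc k)}"
      \<comment> \<open>The left end \<open>cum k\<close> is not covered by \<open>Q_step\<close>
        for \<open>Suc k\<close>; a single point does not affect the integral.\<close>
      by (rule has_integral_spike_finite[where S = "{cum k}", rotated 2])
        (use Q_step[of "Suc k"] Suc.prems in auto)
    with Suc show ?case
      using has_integral_combine[of 0 "cum k" "cum (Suc k)" "\<lambda>x. h (Q x)"]
        cum_mono[of 0 k] cum_mono[of k "Suc k"] by simp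
  qed
  from this[of K] show ?thesis by (simp add: cum_K)
qed

text \<open>An allocation is constant off the finite support, hence Borel, so its mean can be
  computed over quantile levels.\<close>

lemma has_integral_expectation_Q:
  fixes P :: "real \<Rightarrow> real"
  assumes "P \<in> rate_support M B \<rightarrow>\<^sub>E S"
  shows "((\<lambda>x. P (Q x)) has_integral expectation (\<lambda>\<omega>. P (B \<omega>))) {0..1}"
proof -
  have "P \<in> borel_measurable borel"
  proof (rule measurable_discrete_difference)
    show "(\<lambda>_. undefined) \<in> borel_measurable (borel :: real measure)" by simp
    show "countable (rate_support M B)"
      unfolding rate_support_eq by (intro countable_finite finite_imageI finite_atLeastAtMost)
    show "undefined = P x" if "x \<notin> rate_support M B" for x
      using PiE_arb[OF assms that] by simp
  qed auto
  then show ?thesis using has_integral_Q[of P] by (simp add: expectation_B)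
qed

end

text \<open>All levels of user 1 are compressed onto the top mass \<open>\<rho>\<close> of user 2,
  with Jacobian \<open>1 / \<rho>\<close>. For \<open>\<rho> = \<alpha>2 / \<alpha>1\<close> this
  factor weights the powers so that \<open>\<alpha>2\<close> times the integrand is the left side of
  the sum constraint.\<close>

lemma sum_power_quantile:
  fixes F G :: "real \<Rightarrow> real"
  assumes F: "(F has_integral I) {0..1}" and G: "(G has_integral J) {0..1}"
    and \<rho>: "0 < \<rho>" "\<rho> \<le> 1"
  shows "((\<lambda>v. G (v + 1 - \<rho>) + F (v / \<rho>) / \<rho>) has_integral
      (I + J - integral {0..1 - \<rho>} G)) {0..\<rho>}"
    and "G integrable_on {0..1 - \<rho>}"
proof -
  have int: "G integrable_on {0..1}" using G by blast
  then show "G integrable_on {0..1 - \<rho>}"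
    by (rule integrable_on_subinterval) (use \<rho> in auto)
  have "G integrable_on {1 - \<rho>..1}"
    using int by (rule integrable_on_subinterval) (use \<rho> in auto)
  moreover have "integral {0..1 - \<rho>} G + integral {1 - \<rho>..1} G = J"
    using Henstock_Kurzweil_Integration.integral_combine[of 0 "1 - \<rho>" 1 G] \<rho> int G by (simp add: integral_unique)
  ultimately have "(G has_integral (J - integral {0..1 - \<rho>} G)) {1 - \<rho>..1}"
    by (simp add: has_integral_iff)
  from has_integral_affinity[OF this[folded cbox_interval], of 1 "1 - \<rho>"]
  have 1: "((\<lambda>v. G (v + 1 - \<rho>)) has_integral (J - integral {0..1 - \<rho>} G)) {0..\<rho>}"
    using \<rho> image_add_atLeastAtMost'[of "\<rho> - 1" "1 - \<rho>" 1] by (simp add: algebra_simps)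
  from has_integral_affinity[OF F[folded cbox_interval], of "1 / \<rho>" 0]
  have "((\<lambda>v. F (v / \<rho>)) has_integral (\<rho> * I)) {0..\<rho>}"
    using \<rho> by simp
  from has_integral_divide[OF this, of \<rho>] have "((\<lambda>v. F (v / \<rho>) / \<rho>) has_integral I) {0..\<rho>}"
    using \<rho> by simp
  from has_integral_add[OF 1 this]
  show "((\<lambda>v. G (v + 1 - \<rho>) + F (v / \<rho>) / \<rho>) has_integral
      (I + J - integral {0..1 - \<rho>} G)) {0..\<rho>}"
    by (simp add: algebra_simps)
qed

section \<open>Pointwise lower bounds and an allocation that attains them\<close>

theorem theorem8:
  fixes M :: "'a measure" and B1 B2 :: "'a \<Rightarrow> real" and \<alpha>1 \<alpha>2 :: real
    and K1 K2 :: nat and r1 r2 l1 l2 :: "nat \<Rightarrow> real"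
  assumes "prob_space M"
    and "prob_space.indep_var M borel B1 borel B2"
    and "rate_law M B1 K1 r1 l1" and "rate_law M B2 K2 r2 l2"
    and "\<alpha>1 \<ge> \<alpha>2" and "\<alpha>2 > 0"
  shows "min_avg_sum_power \<alpha>1 \<alpha>2 M B1 B2 =
      integral {0..1 - \<alpha>2 / \<alpha>1} (\<lambda>x. (2 powr (2 * inverse_cdf M B2 x) - 1) / \<alpha>2)
    + integral {0..\<alpha>2 / \<alpha>1}
        (\<lambda>v. (2 powr (2 * (inverse_cdf M B2 (v + 1 - \<alpha>2 / \<alpha>1)
                          + inverse_cdf M B1 (\<alpha>1 * v / \<alpha>2))) - 1) / \<alpha>2)"
proof -
  interpret R1: finite_rate M B1 K1 r1 l1
    using assms by (simp add: finite_rate_def finite_rate_axioms_def)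
  interpret R2: finite_rate M B2 K2 r2 l2
    using assms by (simp add: finite_rate_def finite_rate_axioms_def)
  define \<rho> where "\<rho> = \<alpha>2 / \<alpha>1"
  have \<rho>: "0 < \<rho>" "\<rho> \<le> 1" using assms by (auto simp: \<rho>_def)
  have \<alpha>1: "0 < \<alpha>1" "\<alpha>1 * \<rho> = \<alpha>2" "\<And>v. \<alpha>1 * v / \<alpha>2 = v / \<rho>"
    using assms by (auto simp: \<rho>_def)
  \<comment> \<open>Exponentiation turns the sum of rates into a product, the cost for which the
    potentials are made.\<close>
  define A :: "real \<Rightarrow> real" where "A b = 2 powr (2 * b)" for b
  have A_add: "2 powr (2 * (b + b')) = A b' * A b" for b b'
    by (simp add: A_def powr_add distrib_left)
  have A_mono: "b \<le> b' \<Longrightarrow> A b \<le> A b'" and A_ge_1: "0 \<le> b \<Longrightarrow> 1 \<le> A b" for b b'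
    using ge_one_powr_ge_zero[of 2 "2 * b"] by (auto simp: A_def)
  let ?Q1 = R1.Q and ?Q2 = R2.Q
  let ?V = "\<lambda>P1 P2. (\<integral>\<omega>. P1 (B1 \<omega>) \<partial>M) + (\<integral>\<omega>. P2 (B2 \<omega>) \<partial>M)"
  let ?\<Phi> = "\<lambda>x. (A (?Q2 x) - 1) / \<alpha>2"
  let ?\<Psi> = "\<lambda>v. (A (?Q1 (v / \<rho>)) * A (?Q2 (v + 1 - \<rho>)) - 1) / \<alpha>2"
  let ?H = "\<lambda>P1 P2 v. P2 (?Q2 (v + 1 - \<rho>)) + P1 (?Q1 (v / \<rho>)) / \<rho>"

  have V: "P2 \<circ> ?Q2 integrable_on {0..1 - \<rho>}" "?H P1 P2 integrable_on {0..\<rho>}"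
    "?V P1 P2 = integral {0..1 - \<rho>} (P2 \<circ> ?Q2) + integral {0..\<rho>} (?H P1 P2)"
    if "outage_free \<alpha>1 \<alpha>2 M B1 B2 P1 P2" for P1 P2
  proof -
    have "P1 \<in> rate_support M B1 \<rightarrow>\<^sub>E {0..}" "P2 \<in> rate_support M B2 \<rightarrow>\<^sub>E {0..}"
      using that by (auto simp: outage_free_def)
    note * = sum_power_quantile[OF R1.has_integral_expectation_Q[OF this(1)]
        R2.has_integral_expectation_Q[OF this(2)] \<rho>]
    show "P2 \<circ> ?Q2 integrable_on {0..1 - \<rho>}" "?H P1 P2 integrable_on {0..\<rho>}"
      using * by (auto simp: o_def)
    show "?V P1 P2 = integral {0..1 - \<rho>} (P2 \<circ> ?Q2) + integral {0..\<rho>} (?H P1 P2)"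
      using integral_unique[OF *(1)] by (simp add: o_def)
  qed

  have lower: "?\<Phi> x \<le> P2 (?Q2 x)" if "outage_free \<alpha>1 \<alpha>2 M B1 B2 P1 P2" "x \<in> {0..1 - \<rho>}"
    for P1 P2 x
  proof -
    \<comment> \<open>The individual constraints are stated under quantifiers over both supports, so
      some rate of user 1 must be supplied; \<open>?Q1 0\<close> serves.\<close>
    have "?Q2 x \<in> rate_support M B2" "?Q1 0 \<in> rate_support M B1"
      using that \<rho> by (auto intro!: R1.Q_in_support R2.Q_in_support)
    then have "A (?Q2 x) - 1 \<le> \<alpha>2 * P2 (?Q2 x)"
      using that(1) unfolding outage_free_def A_def by blast
    then show ?thesis
      using assms(6) by (simp add: divide_le_eq mult.commute)
  qed
  have upper: "?\<Psi> v \<le> ?H P1 P2 v" if "outage_free \<alpha>1 \<alpha>2 M B1 B2 P1 P2" "v \<in> {0..\<rho>}"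
    for P1 P2 v
  proof -
    have "?Q2 (v + 1 - \<rho>) \<in> rate_support M B2" "?Q1 (v / \<rho>) \<in> rate_support M B1"
      using that \<rho> by (auto intro!: R1.Q_in_support R2.Q_in_support)
    then have "\<alpha>1 * P1 (?Q1 (v / \<rho>)) + \<alpha>2 * P2 (?Q2 (v + 1 - \<rho>))
        \<ge> A (?Q1 (v / \<rho>)) * A (?Q2 (v + 1 - \<rho>)) - 1"
      using that(1) unfolding outage_free_def A_add[symmetric] by (simp add: add.commute)
    moreover have "\<alpha>2 * ?H P1 P2 v
        = \<alpha>1 * P1 (?Q1 (v / \<rho>)) + \<alpha>2 * P2 (?Q2 (v + 1 - \<rho>))"
      using \<rho> by (simp add: \<alpha>1(2)[symmetric] field_simps)
    ultimately show ?thesis using assms(6) by (simp add: divide_le_eq mult.commute)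
  qed

  \<comment> \<open>The lowest mass \<open>1 - \<rho>\<close> of user 2 is matched with a dummy rate \<open>0\<close> of user 1, at
    which the sum constraint with zero power is the individual constraint of user 2.\<close>
  define S1 where "S1 = (\<lambda>x. (1 :: real, A (?Q2 x))) ` {0..1 - \<rho>}"
  define S2 where "S2 = (\<lambda>v. (A (?Q1 (v / \<rho>)), A (?Q2 (v + 1 - \<rho>)))) ` {0..\<rho>}"
  define S where "S = S1 \<union> S2"
  have S1_chain: "s \<le> t \<or> t \<le> s" if st: "s \<in> S1" "t \<in> S1" for s t
  proof -
    obtain x y where "x \<in> {0..1 - \<rho>}" "y \<in> {0..1 - \<rho>}" "s = (1, A (?Q2 x))" "t = (1, A (?Q2 y))"
      using st by (auto simp: S1_def)
    then show ?thesis
      using \<rho> by (cases x y rule: linorder_le_cases)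
        (auto intro!: A_mono R2.Q_mono)
  qed
  have S2_chain: "s \<le> t \<or> t \<le> s" if st: "s \<in> S2" "t \<in> S2" for s t
  proof -
    obtain x y where "x \<in> {0..\<rho>}" "y \<in> {0..\<rho>}"
      "s = (A (?Q1 (x / \<rho>)), A (?Q2 (x + 1 - \<rho>)))" "t = (A (?Q1 (y / \<rho>)), A (?Q2 (y + 1 - \<rho>)))"
      using st by (auto simp: S2_def)
    then show ?thesis
      using \<rho> by (cases x y rule: linorder_le_cases)
        (auto intro!: A_mono R1.Q_mono R2.Q_mono divide_right_mono)
  qed
  \<comment> \<open>The dummy value 1 is at most every \<open>A b\<close> with
    \<open>b \<ge> 0\<close>, and the levels up to \<open>1 - \<rho>\<close> precede those of the
    form \<open>v + 1 - \<rho>\<close>, so the two pieces join into one chain.\<close>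
  have S12: "s \<le> t" if st: "s \<in> S1" "t \<in> S2" for s t
    using st \<rho> by (auto simp: S1_def S2_def
        intro!: A_mono A_ge_1 R2.Q_mono R1.rate_support_nonneg[OF R1.Q_in_support])
  have chain: "s \<le> t \<or> t \<le> s" if "s \<in> S" "t \<in> S" for s t
    using that S1_chain S2_chain S12 unfolding S_def by blast
  have "S \<subseteq> insert 1 (A ` rate_support M B1) \<times> A ` rate_support M B2"
    using \<rho> by (auto simp: S_def S1_def S2_def intro!: imageI R1.Q_in_support R2.Q_in_support)
  then have "finite S"
    by (rule finite_subset) (simp add: R1.rate_support_eq R2.rate_support_eq)
  then obtain f g where eq: "\<And>a b. (a, b) \<in> S \<Longrightarrow> f a + g b = a * b"
    and ge: "\<And>a b. a \<in> fst ` S \<Longrightarrow> b \<in> snd ` S \<Longrightarrow> a * b \<le> f a + g b"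
    using finite_chain_potentials[OF _ chain] by metis
  have S1: "(1, A (?Q2 x)) \<in> S" if "x \<in> {0..1 - \<rho>}" for x
    using that by (auto simp: S_def S1_def)
  have S2: "(A (?Q1 (v / \<rho>)), A (?Q2 (v + 1 - \<rho>))) \<in> S" if "v \<in> {0..\<rho>}" for v
    using that by (auto simp: S_def S2_def)
  \<comment> \<open>The level 0 lies in \<open>{0..1 - \<rho>}\<close> even for
    \<open>\<rho> = 1\<close>, so the chain always contains a dummy point.\<close>
  have one_S: "1 \<in> fst ` S"
    by (rule rev_image_eqI[OF S1[of 0]]) (use \<rho> in auto)
  have fst_S: "A b \<in> fst ` S" if b: "b \<in> rate_support M B1" for b
  proof -
    obtain x where "0 \<le> x" "x \<le> 1" "?Q1 x = b" using R1.Q_surj[OF b] .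
    then show ?thesis
      by (intro rev_image_eqI[OF S2[of "\<rho> * x"]]) (use \<rho> in \<open>auto simp: mult_le_cancel_left1\<close>)
  qed
  have snd_S: "A b \<in> snd ` S" if b: "b \<in> rate_support M B2" for b
  proof -
    obtain x where x: "0 \<le> x" "x \<le> 1" "?Q2 x = b" using R2.Q_surj[OF b] .
    show ?thesis
    proof (cases "x \<le> 1 - \<rho>")
      case True
      with x show ?thesis by (intro rev_image_eqI[OF S1[of x]]) auto
    next
      case False
      with x show ?thesis by (intro rev_image_eqI[OF S2[of "x - (1 - \<rho>)"]]) auto
    qed
  qed
  \<comment> \<open>Adding a constant to \<open>f\<close> and subtracting it from \<open>g\<close>
    preserves the potential property. The constant \<open>f 1\<close> makes the dummy rate free, and
    the \<open>- 1\<close> of the sum constraint is charged to user 2.\<close>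
  define P1 where "P1 = restrict (\<lambda>b. (f (A b) - f 1) / \<alpha>1) (rate_support M B1)"
  define P2 where "P2 = restrict (\<lambda>b. (g (A b) + f 1 - 1) / \<alpha>2) (rate_support M B2)"
  have P1: "\<alpha>1 * P1 b = f (A b) - f 1" if "b \<in> rate_support M B1" for b
    using that \<alpha>1 by (simp add: P1_def)
  have P2: "\<alpha>2 * P2 b = g (A b) + f 1 - 1" if "b \<in> rate_support M B2" for b
    using that assms(6) by (simp add: P2_def)
  \<comment> \<open>At the smallest value \<open>?q\<close> of user 2, where the dummy point gives
    equality, the potentials yield \<open>f (A b) - f 1 \<ge> (A b - 1) * ?q\<close>, and
    \<open>?q \<ge> 1\<close>.\<close>
  have P1_ge: "A b - 1 \<le> \<alpha>1 * P1 b" if b: "b \<in> rate_support M B1" for b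
  proof -
    let ?q = "A (?Q2 0)"
    have Q0: "?Q2 0 \<in> rate_support M B2" by (rule R2.Q_in_support) auto
    have "f 1 + g ?q = ?q" using eq[OF S1[of 0]] \<rho> by simp
    moreover have "A b * ?q \<le> f (A b) + g ?q" using fst_S[OF b] snd_S[OF Q0] by (rule ge)
    moreover have "(A b - 1) * 1 \<le> (A b - 1) * ?q"
      using A_ge_1[OF R1.rate_support_nonneg[OF b]] A_ge_1[OF R2.rate_support_nonneg[OF Q0]]
      by (intro mult_left_mono) auto
    ultimately show ?thesis by (simp add: P1[OF b] algebra_simps)
  qed
  \<comment> \<open>The potential inequality against the dummy value 1 is exactly the individual
    constraint of user 2.\<close>
  have P2_ge: "A b - 1 \<le> \<alpha>2 * P2 b" if b: "b \<in> rate_support M B2" for b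
    using ge[OF one_S snd_S[OF b]] by (simp add: P2[OF b])
  have "0 \<le> \<alpha>1 * P1 b" if "b \<in> rate_support M B1" for b
    using P1_ge[OF that] A_ge_1[OF R1.rate_support_nonneg[OF that]] by linarith
  then have P1_nonneg: "0 \<le> P1 b" if "b \<in> rate_support M B1" for b
    using that \<alpha>1(1) by (simp add: zero_le_mult_iff)
  have "0 \<le> \<alpha>2 * P2 b" if "b \<in> rate_support M B2" for b
    using P2_ge[OF that] A_ge_1[OF R2.rate_support_nonneg[OF that]] by linarith
  then have P2_nonneg: "0 \<le> P2 b" if "b \<in> rate_support M B2" for b
    using that assms(6) by (simp add: zero_le_mult_iff)
  have opt: "outage_free \<alpha>1 \<alpha>2 M B1 B2 P1 P2"
    unfolding outage_free_def
  proof (intro conjI ballI)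
    show "P1 \<in> rate_support M B1 \<rightarrow>\<^sub>E {0..}"
      using P1_nonneg by (auto simp: P1_def)
    show "P2 \<in> rate_support M B2 \<rightarrow>\<^sub>E {0..}"
      using P2_nonneg by (auto simp: P2_def)
    fix b1 b2 assume b: "b1 \<in> rate_support M B1" "b2 \<in> rate_support M B2"
    show "2 powr (2 * b1) - 1 \<le> \<alpha>1 * P1 b1" "2 powr (2 * b2) - 1 \<le> \<alpha>2 * P2 b2"
      using P1_ge[OF b(1)] P2_ge[OF b(2)] by (simp_all add: A_def)
    show "2 powr (2 * (b1 + b2)) - 1 \<le> \<alpha>1 * P1 b1 + \<alpha>2 * P2 b2"
      using ge[OF fst_S[OF b(1)] snd_S[OF b(2)]]
      unfolding P1[OF b(1)] P2[OF b(2)] A_add by (simp add: mult.commute)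
  qed
  \<comment> \<open>Equality of the potentials on the chain makes both pointwise lower bounds tight
    along the pairing.\<close>
  have lower_eq: "(P2 \<circ> ?Q2) x = ?\<Phi> x" if x: "x \<in> {0..1 - \<rho>}" for x
  proof -
    have "?Q2 x \<in> rate_support M B2" using x \<rho> by (auto intro!: R2.Q_in_support)
    then show ?thesis using eq[OF S1[OF x]] by (simp add: P2_def)
  qed
  have upper_eq: "?H P1 P2 v = ?\<Psi> v" if v: "v \<in> {0..\<rho>}" for v
  proof -
    have "?Q2 (v + 1 - \<rho>) \<in> rate_support M B2" "?Q1 (v / \<rho>) \<in> rate_support M B1"
      using v \<rho> by (auto intro!: R1.Q_in_support R2.Q_in_support)
    then show ?thesis
      using eq[OF S2[OF v]] assms(6) \<rho>
      by (simp add: P1_def P2_def \<alpha>1 add_divide_distrib[symmetric] diff_divide_distrib[symmetric])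
  qed
  have opt_val: "?V P1 P2 = integral {0..1 - \<rho>} ?\<Phi> + integral {0..\<rho>} ?\<Psi>"
    unfolding V(3)[OF opt]
    by (intro arg_cong2[where f = "(+)"] Henstock_Kurzweil_Integration.integral_cong
        lower_eq upper_eq)
  \<comment> \<open>The bounding integrands inherit integrability from the optimal allocation, with
    which they agree on these intervals; the final comparison of integrals requires it.\<close>
  have int\<Phi>: "?\<Phi> integrable_on {0..1 - \<rho>}"
    using V(1)[OF opt] by (rule integrable_eq) (rule lower_eq)
  have int\<Psi>: "?\<Psi> integrable_on {0..\<rho>}"
    using V(2)[OF opt] by (rule integrable_eq) (rule upper_eq)

  have "min_avg_sum_power \<alpha>1 \<alpha>2 M B1 B2 = ?V P1 P2"
    unfolding min_avg_sum_power_def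
  proof (rule cInf_eq_minimum)
    show "?V P1 P2 \<in> {?V P1 P2 | P1 P2. outage_free \<alpha>1 \<alpha>2 M B1 B2 P1 P2}"
      using opt by blast
    fix y assume "y \<in> {?V P1 P2 | P1 P2. outage_free \<alpha>1 \<alpha>2 M B1 B2 P1 P2}"
    then obtain P1' P2' where y: "y = ?V P1' P2'" and free: "outage_free \<alpha>1 \<alpha>2 M B1 B2 P1' P2'"
      by blast
    show "?V P1 P2 \<le> y"
      unfolding y opt_val V(3)[OF free]
      using lower[OF free] upper[OF free]
      by (intro add_mono integral_le int\<Phi> int\<Psi> V[OF free]) simp_all
  qed
  then show ?thesis
    unfolding opt_val \<rho>_def[symmetric] \<alpha>1(3) A_add by (simp add: A_def)
qed

end
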